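(* Let $\mathcal A,\mathcal B$ be (binary) unital associative algebras over $\mathbb C$ with involutions $a\mapsto a^\star$ and $b\mapsto b^\ast$ respectively, let $\mathcal M$ be an $\mathcal A$-$\mathcal B$-bimodule with associated $\mathcal B$-$\mathcal A$-bimodule $\overline{\mathcal M}$, and let $\varphi:\mathcal M\otimes_{\mathcal B}\overline{\mathcal M}\to\mathcal A$ and $\psi:\overline{\mathcal M}\otimes_{\mathcal A}\mathcal M\to\mathcal B$ be homomorphisms of $\mathcal A$-bimodules and of $\mathcal B$-bimodules respectively such that for all $m,n,p\in\mathcal M$ $$(\varphi(m\otimes\bar n))^\star=\varphi(n\otimes\bar m),\quad(\psi(\bar m\otimes n))^\ast=\psi(\bar n\otimes m),\quad\varphi(m\otimes\bar n)\cdot p=m\cdot\psi(\bar n\otimes p).$$ Define the ternary law of composition $\tau$ on $\mathcal M$ by $\tau(m,n,p)=\varphi(m\otimes\bar n)\cdot p$ for $m,n,p\in\mathcal M$. Then $(\mathcal M,\tau)$ is an lr-partially associative ternary algebra.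
   Context: A ternary algebra $(\mathfrak A,\tau)$ is a complex vector space $\mathfrak A$ with a trilinear map $\tau:\mathfrak A\times\mathfrak A\times\mathfrak A\to\mathfrak A$ (a ternary law of composition, or ternary multiplication); it is lr-partially associative if $\tau(\tau(a,b,c),d,f)=\tau(a,b,\tau(c,d,f))$ for all $a,b,c,d,f\in\mathfrak A$. The bimodule $\mathcal M$ is regarded as a vector space over $\mathbb C$. $\overline{\mathcal M}$ is an abelian group isomorphic to the abelian group $\mathcal M$ via an isomorphism $\varepsilon:\mathcal M\to\overline{\mathcal M}$, written $\varepsilon(m)=\bar m$, and it is made into a $\mathcal B$-$\mathcal A$-bimodule by $\varepsilon(m)\cdot a=\varepsilon(a^\star\cdot m)$ and $b\cdot\varepsilon(m)=\varepsilon(m\cdot b^\ast)$ for $m\in\mathcal M$, $a\in\mathcal A$, $b\in\mathcal B$. The tensor product $\mathcal M\otimes_{\mathcal B}\overline{\mathcal M}$ is an $\mathcal A$-bimodule and $\overline{\mathcal M}\otimes_{\mathcal A}\mathcal M$ is a $\mathcal B$-bimodule, and $\mathcal A$, $\mathcal B$ are regarded as bimodules over themselves.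
   Formalization: The involutions are taken to be complex-linear; with conjugate-linear involutions the claim fails: for A = B = M = C with complex conjugation and φ(m⊗n̄) = m·conj(n), τ(m,n,p) = m·conj(n)·p is not linear in n. *)

theory Defs
  imports Complex_Main "HOL-Library.Poly_Mapping" "HOL-Library.Set_Algebras"
begin

section \<open>Algebras with involution and bimodules\<close>

text \<open>The sort \<open>{ring, monoid_mult}\<close> is used instead of \<open>ring_1\<close> so that the zero algebra
  is not excluded.\<close>

locale complex_algebra = vector_space scale
  for scale :: "complex \<Rightarrow> 'a::{ring, monoid_mult} \<Rightarrow> 'a" +
  assumes scale_mult_left: "scale c x * y = scale c (x * y)"
    and scale_mult_right: "x * scale c y = scale c (x * y)"

text \<open>An involution of an algebra over \<open>\<complex>\<close> is a \<open>\<complex>\<close>-linear anti-automorphism of period two.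
  With a conjugate-linear star the product \<open>\<tau>(m, n, p) = \<phi>(m \<otimes> \<epsilon>(n)) \<cdot> p\<close> would be
  conjugate-linear in \<open>n\<close>, hence not trilinear.\<close>

locale involutive_algebra = complex_algebra scale
  for scale :: "complex \<Rightarrow> 'a::{ring, monoid_mult} \<Rightarrow> 'a" +
  fixes star :: "'a \<Rightarrow> 'a"
  assumes star_add: "star (x + y) = star x + star y"
    and star_scale: "star (scale c x) = scale c (star x)"
    and star_mult: "star (x * y) = star y * star x"
    and star_star: "star (star x) = x"

text \<open>A bimodule over two \<open>\<complex>\<close>-algebras, regarded as a vector space over \<open>\<complex>\<close>: the scalar
  \<open>c\<close> acts as \<open>c 1\<close>, from either side.\<close>

locale bimodule =
  A: complex_algebra scaleA + B: complex_algebra scaleB + vector_space scale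
  for scaleA :: "complex \<Rightarrow> 'a::{ring, monoid_mult} \<Rightarrow> 'a"
    and scaleB :: "complex \<Rightarrow> 'b::{ring, monoid_mult} \<Rightarrow> 'b"
    and scale :: "complex \<Rightarrow> 'm::ab_group_add \<Rightarrow> 'm" +
  fixes lact :: "'a \<Rightarrow> 'm \<Rightarrow> 'm"
    and ract :: "'m \<Rightarrow> 'b \<Rightarrow> 'm"
  assumes lact_add_right: "lact a (m + n) = lact a m + lact a n"
    and lact_add_left: "lact (a + a') m = lact a m + lact a' m"
    and lact_mult: "lact (a * a') m = lact a (lact a' m)"
    and lact_one: "lact 1 m = m"
    and ract_add_left: "ract (m + n) b = ract m b + ract n b"
    and ract_add_right: "ract m (b + b') = ract m b + ract m b'"
    and ract_mult: "ract m (b * b') = ract (ract m b) b'"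
    and ract_one: "ract m 1 = m"
    and lact_ract: "ract (lact a m) b = lact a (ract m b)"
    and lact_scale_one: "lact (scaleA c 1) m = scale c m"
    and ract_scale_one: "ract m (scaleB c 1) = scale c m"

text \<open>\<open>lactbar\<close> and \<open>ractbar\<close> are the actions of \<open>B\<close> and \<open>A\<close> on the abelian group \<open>'n\<close>
  that the isomorphism \<open>\<epsilon>\<close> transports from \<open>'m\<close>; as \<open>\<epsilon>\<close> is onto they are determined by
  the two equations.\<close>

definition conjugate_bimodule ::
  "('a \<Rightarrow> 'a) \<Rightarrow> ('b \<Rightarrow> 'b) \<Rightarrow> ('a \<Rightarrow> 'm \<Rightarrow> 'm) \<Rightarrow> ('m \<Rightarrow> 'b \<Rightarrow> 'm)
    \<Rightarrow> ('m::ab_group_add \<Rightarrow> 'n::ab_group_add) \<Rightarrow> ('b \<Rightarrow> 'n \<Rightarrow> 'n) \<Rightarrow> ('n \<Rightarrow> 'a \<Rightarrow> 'n) \<Rightarrow> bool"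
  where
  "conjugate_bimodule starA starB lact ract \<epsilon> lactbar ractbar \<longleftrightarrow>
     bij \<epsilon> \<and> (\<forall>m n. \<epsilon> (m + n) = \<epsilon> m + \<epsilon> n) \<and>
     (\<forall>m a. ractbar (\<epsilon> m) a = \<epsilon> (lact (starA a) m)) \<and>
     (\<forall>b m. lactbar b (\<epsilon> m) = \<epsilon> (ract m (starB b)))"


section \<open>The tensor product over a noncommutative ring\<close>

text \<open>For a right module with action \<open>ract\<close> and a left module with action \<open>lact\<close> over the same
  ring, the tensor product is the free abelian group on all pairs modulo \<open>tensor_rels\<close>. Its
  elements are the cosets, and its addition is the elementwise sum of sets.\<close>

inductive_set tensor_rels ::
  "('m::ab_group_add \<Rightarrow> 'r \<Rightarrow> 'm) \<Rightarrow> ('r \<Rightarrow> 'n::ab_group_add \<Rightarrow> 'n) \<Rightarrow> ('m \<times> 'n \<Rightarrow>\<^sub>0 int) set"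
  for ract :: "'m \<Rightarrow> 'r \<Rightarrow> 'm" and lact :: "'r \<Rightarrow> 'n \<Rightarrow> 'n"
  where
    add_left: "frag_of (x + x', y) - frag_of (x, y) - frag_of (x', y) \<in> tensor_rels ract lact"
  | add_right: "frag_of (x, y + y') - frag_of (x, y) - frag_of (x, y') \<in> tensor_rels ract lact"
  | balanced: "frag_of (ract x r, y) - frag_of (x, lact r y) \<in> tensor_rels ract lact"
  | zero: "0 \<in> tensor_rels ract lact"
  | diff: "u \<in> tensor_rels ract lact \<Longrightarrow> v \<in> tensor_rels ract lact \<Longrightarrow> u - v \<in> tensor_rels ract lact"

definition tensor_product ::
  "('m::ab_group_add \<Rightarrow> 'r \<Rightarrow> 'm) \<Rightarrow> ('r \<Rightarrow> 'n::ab_group_add \<Rightarrow> 'n) \<Rightarrow> ('m \<times> 'n \<Rightarrow>\<^sub>0 int) set set"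
  where "tensor_product ract lact = range (\<lambda>u. u +o tensor_rels ract lact)"

definition tensor ::
  "('m::ab_group_add \<Rightarrow> 'r \<Rightarrow> 'm) \<Rightarrow> ('r \<Rightarrow> 'n::ab_group_add \<Rightarrow> 'n) \<Rightarrow> 'm \<Rightarrow> 'n \<Rightarrow> ('m \<times> 'n \<Rightarrow>\<^sub>0 int) set"
  where "tensor ract lact x y = frag_of (x, y) +o tensor_rels ract lact"

text \<open>The outer actions, induced by an action \<open>f\<close> on the left factor and \<open>g\<close> on the right factor
  respectively; the summand \<open>tensor_rels\<close> turns the image of a coset into a coset again.\<close>

definition tensor_lact ::
  "('m::ab_group_add \<Rightarrow> 'r \<Rightarrow> 'm) \<Rightarrow> ('r \<Rightarrow> 'n::ab_group_add \<Rightarrow> 'n) \<Rightarrow> ('s \<Rightarrow> 'm \<Rightarrow> 'm)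
    \<Rightarrow> 's \<Rightarrow> ('m \<times> 'n \<Rightarrow>\<^sub>0 int) set \<Rightarrow> ('m \<times> 'n \<Rightarrow>\<^sub>0 int) set"
  where "tensor_lact ract lact f s X =
    frag_extend (\<lambda>(x, y). frag_of (f s x, y)) ` X + tensor_rels ract lact"

definition tensor_ract ::
  "('m::ab_group_add \<Rightarrow> 'r \<Rightarrow> 'm) \<Rightarrow> ('r \<Rightarrow> 'n::ab_group_add \<Rightarrow> 'n) \<Rightarrow> ('n \<Rightarrow> 's \<Rightarrow> 'n)
    \<Rightarrow> ('m \<times> 'n \<Rightarrow>\<^sub>0 int) set \<Rightarrow> 's \<Rightarrow> ('m \<times> 'n \<Rightarrow>\<^sub>0 int) set"
  where "tensor_ract ract lact g X s =
    frag_extend (\<lambda>(x, y). frag_of (x, g y s)) ` X + tensor_rels ract lact"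

text \<open>Bimodule homomorphisms from a bimodule with carrier \<open>T\<close> to a bimodule on a whole type.
  Complex scalars act through the algebras, so linearity over \<open>\<complex>\<close> is not a separate condition.\<close>

definition bimodule_hom ::
  "'t set \<Rightarrow> ('a \<Rightarrow> 't \<Rightarrow> 't) \<Rightarrow> ('t \<Rightarrow> 'b \<Rightarrow> 't) \<Rightarrow> ('a \<Rightarrow> 'u \<Rightarrow> 'u) \<Rightarrow> ('u \<Rightarrow> 'b \<Rightarrow> 'u)
    \<Rightarrow> ('t::plus \<Rightarrow> 'u::plus) \<Rightarrow> bool"
  where
  "bimodule_hom T lact ract lact' ract' h \<longleftrightarrow>
     (\<forall>X\<in>T. \<forall>Y\<in>T. h (X + Y) = h X + h Y) \<and>
     (\<forall>a. \<forall>X\<in>T. h (lact a X) = lact' a (h X)) \<and>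
     (\<forall>b. \<forall>X\<in>T. h (ract X b) = ract' (h X) b)"


section \<open>Ternary algebras\<close>

definition ternary_algebra ::
  "(complex \<Rightarrow> 'm::ab_group_add \<Rightarrow> 'm) \<Rightarrow> ('m \<Rightarrow> 'm \<Rightarrow> 'm \<Rightarrow> 'm) \<Rightarrow> bool"
  where
  "ternary_algebra scale \<tau> \<longleftrightarrow>
     vector_space scale \<and>
     (\<forall>b c. Vector_Spaces.linear scale scale (\<lambda>a. \<tau> a b c)) \<and>
     (\<forall>a c. Vector_Spaces.linear scale scale (\<lambda>b. \<tau> a b c)) \<and>
     (\<forall>a b. Vector_Spaces.linear scale scale (\<lambda>c. \<tau> a b c))"

definition lr_partially_associative :: "('m \<Rightarrow> 'm \<Rightarrow> 'm \<Rightarrow> 'm) \<Rightarrow> bool"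
  where "lr_partially_associative \<tau> \<longleftrightarrow>
    (\<forall>a b c d f. \<tau> (\<tau> a b c) d f = \<tau> a b (\<tau> c d f))"


section \<open>Consistency of the constructions\<close>

lemma tensor_rels_uminus: "u \<in> tensor_rels ract lact \<Longrightarrow> - u \<in> tensor_rels ract lact"
  using tensor_rels.diff[OF tensor_rels.zero] by fastforce

lemma tensor_rels_add:
  "u \<in> tensor_rels ract lact \<Longrightarrow> v \<in> tensor_rels ract lact \<Longrightarrow> u + v \<in> tensor_rels ract lact"
  using tensor_rels.diff[OF _ tensor_rels_uminus] by fastforce

lemma coset_eq_iff:
  "u +o tensor_rels ract lact = v +o tensor_rels ract lact \<longleftrightarrow> u - v \<in> tensor_rels ract lact"
proof
  assume "u +o tensor_rels ract lact = v +o tensor_rels ract lact"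
  moreover have "u \<in> u +o tensor_rels ract lact"
    using tensor_rels.zero by (force simp: elt_set_plus_def)
  ultimately show "u - v \<in> tensor_rels ract lact"
    by (auto simp: elt_set_plus_def)
next
  assume *: "u - v \<in> tensor_rels ract lact"
  have "u + w = v + ((u - v) + w)" "v + w = u + (w - (u - v))" for w
    by (auto simp: algebra_simps)
  then show "u +o tensor_rels ract lact = v +o tensor_rels ract lact"
    unfolding elt_set_plus_def using tensor_rels_add[OF *] tensor_rels.diff[OF _ *] by blast
qed

lemma coset_add:
  "(u +o tensor_rels ract lact) + (v +o tensor_rels ract lact) = (u + v) +o tensor_rels ract lact"
proof -
  have "tensor_rels ract lact + tensor_rels ract lact = tensor_rels ract lact"
    using tensor_rels_add tensor_rels.zero by (force simp: set_plus_def)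
  then show ?thesis
    by (metis set_plus_rearrange)
qed

lemma image_coset:
  fixes h :: "('m::ab_group_add \<times> 'n::ab_group_add) \<Rightarrow> ('m \<times> 'n)"
  assumes "\<And>w. w \<in> tensor_rels ract lact \<Longrightarrow>
             frag_extend (\<lambda>p. frag_of (h p)) w \<in> tensor_rels ract lact"
  shows "frag_extend (\<lambda>p. frag_of (h p)) ` (u +o tensor_rels ract lact) + tensor_rels ract lact
    = frag_extend (\<lambda>p. frag_of (h p)) u +o tensor_rels ract lact" (is "?L = ?R")
proof
  show "?L \<subseteq> ?R"
    using tensor_rels_add assms
    by (force simp: set_plus_def elt_set_plus_def frag_extend_add add.assoc)
  have "frag_extend (\<lambda>p. frag_of (h p)) u \<in>
      frag_extend (\<lambda>p. frag_of (h p)) ` (u +o tensor_rels ract lact)"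
    using tensor_rels.zero by (force simp: elt_set_plus_def)
  then show "?R \<subseteq> ?L"
    by (auto simp: set_plus_def elt_set_plus_def)
qed

lemma tensor_lact_coset:
  assumes "\<And>x x'. f s (x + x') = f s x + f s x'" and "\<And>x r. f s (ract x r) = ract (f s x) r"
  shows "tensor_lact ract lact f s (u +o tensor_rels ract lact) =
    frag_extend (\<lambda>(x, y). frag_of (f s x, y)) u +o tensor_rels ract lact"
proof -
  have "frag_extend (\<lambda>p. frag_of (case p of (x, y) \<Rightarrow> (f s x, y))) w \<in> tensor_rels ract lact"
    if "w \<in> tensor_rels ract lact" for w
    using that
    by induction (auto simp: frag_extend_diff assms intro: tensor_rels.intros)
  from image_coset[OF this] show ?thesis
    by (simp add: tensor_lact_def split_def)
qed

lemma tensor_ract_coset: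
  assumes "\<And>y y'. g (y + y') s = g y s + g y' s" and "\<And>r y. g (lact r y) s = lact r (g y s)"
  shows "tensor_ract ract lact g (u +o tensor_rels ract lact) s =
    frag_extend (\<lambda>(x, y). frag_of (x, g y s)) u +o tensor_rels ract lact"
proof -
  have "frag_extend (\<lambda>p. frag_of (case p of (x, y) \<Rightarrow> (x, g y s))) w \<in> tensor_rels ract lact"
    if "w \<in> tensor_rels ract lact" for w
    using that
    by induction (auto simp: frag_extend_diff assms intro: tensor_rels.intros)
  from image_coset[OF this] show ?thesis
    by (simp add: tensor_ract_def split_def)
qed

lemma tensor_in_tensor_product: "tensor ract lact x y \<in> tensor_product ract lact"
  by (simp add: tensor_def tensor_product_def)

lemma tensor_add_left:
  "tensor ract lact (x + x') y = tensor ract lact x y + tensor ract lact x' y"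
  unfolding tensor_def coset_add coset_eq_iff
  using tensor_rels.add_left by (metis diff_diff_eq)

lemma tensor_add_right:
  "tensor ract lact x (y + y') = tensor ract lact x y + tensor ract lact x y'"
  unfolding tensor_def coset_add coset_eq_iff
  using tensor_rels.add_right by (metis diff_diff_eq)

lemma tensor_balanced: "tensor ract lact (ract x r) y = tensor ract lact x (lact r y)"
  unfolding tensor_def coset_eq_iff by (rule tensor_rels.balanced)

lemma tensor_lact_tensor:
  assumes "\<And>x x'. f s (x + x') = f s x + f s x'" and "\<And>x r. f s (ract x r) = ract (f s x) r"
  shows "tensor_lact ract lact f s (tensor ract lact x y) = tensor ract lact (f s x) y"
  using tensor_lact_coset[of f s ract lact, OF assms] by (simp add: tensor_def)

lemma tensor_ract_tensor:
  assumes "\<And>y y'. g (y + y') s = g y s + g y' s" and "\<And>r y. g (lact r y) s = lact r (g y s)"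
  shows "tensor_ract ract lact g (tensor ract lact x y) s = tensor ract lact x (g y s)"
  using tensor_ract_coset[of g s lact ract, OF assms] by (simp add: tensor_def)

lemma bimodule_conjugate:
  assumes "involutive_algebra scaleA starA" and "involutive_algebra scaleB starB"
    and "bimodule scaleA scaleB scale lact ract"
    and "conjugate_bimodule starA starB lact ract \<epsilon> lactbar ractbar"
  shows "bimodule scaleB scaleA (\<lambda>c x. lactbar (scaleB c 1) x) lactbar ractbar"
proof -
  interpret A: involutive_algebra scaleA starA by fact
  interpret B: involutive_algebra scaleB starB by fact
  interpret M: bimodule scaleA scaleB scale lact ract by fact
  have star1: "starA 1 = 1" "starB 1 = 1"
    by (metis A.star_mult A.star_star mult_1 mult_1_right)
       (metis B.star_mult B.star_star mult_1 mult_1_right)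
  have E: "bij \<epsilon>" and add [simp]: "\<epsilon> m + \<epsilon> n = \<epsilon> (m + n)"
    and [simp]: "ractbar (\<epsilon> m) a = \<epsilon> (lact (starA a) m)"
      "lactbar b (\<epsilon> m) = \<epsilon> (ract m (starB b))" for m n a b
    using assms(4) by (auto simp: conjugate_bimodule_def)
  have ex: "\<exists>m. x = \<epsilon> m" for x
    using E by (metis bij_pointE)
  show ?thesis
  proof (unfold_locales, goal_cases)
    case (1 c x y) then show ?case
      using ex[of x] ex[of y] by (auto simp: M.ract_add_left)
  next
    case (2 c d x) then show ?case
      using ex[of x] by (auto simp: B.scale_left_distrib B.star_add M.ract_add_right)
  next
    case (3 c d x) then show ?case
      using ex[of x] by (auto simp: B.star_scale star1 M.ract_scale_one ac_simps)
  next
    case (4 x) then show ?case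
      using ex[of x] by (auto simp: star1 M.ract_one)
  next
    case (5 a m n) then show ?case
      using ex[of m] ex[of n] by (auto simp: M.ract_add_left)
  next
    case (6 a a' m) then show ?case
      using ex[of m] by (auto simp: B.star_add M.ract_add_right)
  next
    case (7 a a' m) then show ?case
      using ex[of m] by (auto simp: B.star_mult M.ract_mult)
  next
    case (8 m) then show ?case
      using ex[of m] by (auto simp: star1 M.ract_one)
  next
    case (9 m n b) then show ?case
      using ex[of m] ex[of n] by (auto simp: M.lact_add_right)
  next
    case (10 m b b') then show ?case
      using ex[of m] by (auto simp: A.star_add M.lact_add_left)
  next
    case (11 m b b') then show ?case
      using ex[of m] by (auto simp: A.star_mult M.lact_mult)
  next
    case (12 m) then show ?case
      using ex[of m] by (auto simp: star1 M.lact_one)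
  next
    case (13 a m b) then show ?case
      using ex[of m] by (auto simp: M.lact_ract)
  next
    case (14 c m) then show ?case by simp
  next
    case (15 m c) then show ?case
      using ex[of m]
      by (auto simp: A.star_scale B.star_scale star1 M.lact_scale_one M.ract_scale_one)
  qed
qed

end

theory Submission
  imports Defs
begin

text \<open>Put \<open>P m n\<close> for the value of \<phi> at the tensor of \<open>m\<close> and
  \<open>\<epsilon> n\<close>, so that \<tau> is \<open>P m n\<close> acting on the third argument.
  Since \<phi> is left linear over the first algebra, \<open>P (lact a m) n = a * P m n\<close>;
  hence both bracketings in lr-partial associativity are the action of the product
  \<open>P a b * P c d\<close> on \<open>f\<close>. Additivity of \<tau> is inherited from the
  tensor product, \<epsilon> and the action. For homogeneity, a scalar \<open>c\<close> acts as
  \<open>c\<close> times the unit of an algebra and so passes through the bimodule maps; in the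
  middle slot it meets the involution, which is complex linear and fixes it.
  \<open>bimodule_hom_tensor\<close> carries the passage from \<phi> to \<open>P\<close>.\<close>

text \<open>Scalars can also be realized through the right action, which commutes with the left
  one.\<close>

lemma (in bimodule) lact_scale: "lact a (scale c m) = scale c (lact a m)"
  by (simp add: ract_scale_one[symmetric] lact_ract)

lemma (in involutive_algebra) star_one: "star 1 = 1"
  by (metis star_mult star_star mult_1 mult_1_right)

text \<open>Reduces a homomorphism on cosets to its values on elementary tensors. The outer actions
  are computed there factor by factor, because each is additive and commutes with the inner action
  over which the tensor product is balanced.\<close>

lemma bimodule_hom_tensor:
  fixes \<phi> :: "('m::ab_group_add \<times> 'n::ab_group_add \<Rightarrow>\<^sub>0 int) set \<Rightarrow> 'u::plus"
  assumes "bimodule scaleA scaleB scale lact ract"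
    and "bimodule scaleB scaleC scale' lactbar ractbar"
    and "bimodule_hom (tensor_product ract lactbar)
           (tensor_lact ract lactbar lact) (tensor_ract ract lactbar ractbar) lact' ract' \<phi>"
  shows "\<phi> (tensor ract lactbar (x + x') y) =
           \<phi> (tensor ract lactbar x y) + \<phi> (tensor ract lactbar x' y)"
    and "\<phi> (tensor ract lactbar x (y + y')) =
           \<phi> (tensor ract lactbar x y) + \<phi> (tensor ract lactbar x y')"
    and "\<phi> (tensor ract lactbar (lact a x) y) = lact' a (\<phi> (tensor ract lactbar x y))"
    and "\<phi> (tensor ract lactbar x (ractbar y c)) = ract' (\<phi> (tensor ract lactbar x y)) c"
proof -
  interpret M: bimodule scaleA scaleB scale lact ract by fact
  interpret N: bimodule scaleB scaleC scale' lactbar ractbar by fact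
  note hom = assms(3)[unfolded bimodule_hom_def]
  show "\<phi> (tensor ract lactbar (x + x') y) =
      \<phi> (tensor ract lactbar x y) + \<phi> (tensor ract lactbar x' y)"
    and "\<phi> (tensor ract lactbar x (y + y')) =
      \<phi> (tensor ract lactbar x y) + \<phi> (tensor ract lactbar x y')"
    using hom by (simp_all add: tensor_add_left tensor_add_right tensor_in_tensor_product)
  have "tensor_lact ract lactbar lact a (tensor ract lactbar x y) =
      tensor ract lactbar (lact a x) y"
    by (rule tensor_lact_tensor) (simp_all add: M.lact_add_right M.lact_ract)
  then show "\<phi> (tensor ract lactbar (lact a x) y) = lact' a (\<phi> (tensor ract lactbar x y))"
    using hom by (metis tensor_in_tensor_product)
  have "tensor_ract ract lactbar ractbar (tensor ract lactbar x y) c =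
      tensor ract lactbar x (ractbar y c)"
    by (rule tensor_ract_tensor) (simp_all add: N.ract_add_left N.lact_ract)
  then show "\<phi> (tensor ract lactbar x (ractbar y c)) = ract' (\<phi> (tensor ract lactbar x y)) c"
    using hom by (metis tensor_in_tensor_product)
qed

theorem proposition3p1:
  fixes scaleA :: "complex \<Rightarrow> 'a::{ring, monoid_mult} \<Rightarrow> 'a"
    and scaleB :: "complex \<Rightarrow> 'b::{ring, monoid_mult} \<Rightarrow> 'b"
    and scale :: "complex \<Rightarrow> 'm::ab_group_add \<Rightarrow> 'm"
    and \<epsilon> :: "'m \<Rightarrow> 'n::ab_group_add"
    and \<phi> :: "('m \<times> 'n \<Rightarrow>\<^sub>0 int) set \<Rightarrow> 'a"
    and \<psi> :: "('n \<times> 'm \<Rightarrow>\<^sub>0 int) set \<Rightarrow> 'b"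
    and \<tau> :: "'m \<Rightarrow> 'm \<Rightarrow> 'm \<Rightarrow> 'm"
  assumes "involutive_algebra scaleA starA"
    and "involutive_algebra scaleB starB"
    and "bimodule scaleA scaleB scale lact ract"
    and "conjugate_bimodule starA starB lact ract \<epsilon> lactbar ractbar"
    and "bimodule_hom (tensor_product ract lactbar)
           (tensor_lact ract lactbar lact) (tensor_ract ract lactbar ractbar)
           (\<lambda>a x. a * x) (\<lambda>x a. x * a) \<phi>"
    and "bimodule_hom (tensor_product ractbar lact)
           (tensor_lact ractbar lact lactbar) (tensor_ract ractbar lact ract)
           (\<lambda>b y. b * y) (\<lambda>y b. y * b) \<psi>"
    and "\<And>m n. starA (\<phi> (tensor ract lactbar m (\<epsilon> n))) = \<phi> (tensor ract lactbar n (\<epsilon> m))"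
    and "\<And>m n. starB (\<psi> (tensor ractbar lact (\<epsilon> m) n)) = \<psi> (tensor ractbar lact (\<epsilon> n) m)"
    and "\<And>m n p. lact (\<phi> (tensor ract lactbar m (\<epsilon> n))) p
                 = ract m (\<psi> (tensor ractbar lact (\<epsilon> n) p))"
    and "\<And>m n p. \<tau> m n p = lact (\<phi> (tensor ract lactbar m (\<epsilon> n))) p"
  shows "ternary_algebra scale \<tau> \<and> lr_partially_associative \<tau>"
proof -
  interpret A: involutive_algebra scaleA starA by fact
  interpret M: bimodule scaleA scaleB scale lact ract by fact
  have \<epsilon>_add: "\<epsilon> (m + n) = \<epsilon> m + \<epsilon> n"
    and ractbar: "ractbar (\<epsilon> m) a = \<epsilon> (lact (starA a) m)" for m n a
    using assms(4) by (auto simp: conjugate_bimodule_def)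
  define P where "P m n = \<phi> (tensor ract lactbar m (\<epsilon> n))" for m n
  have \<tau>: "\<tau> m n p = lact (P m n) p" for m n p
    using assms(10) by (simp add: P_def)
  note hom = bimodule_hom_tensor[OF assms(3) bimodule_conjugate[OF assms(1-4)] assms(5)]
  have P_add: "P (m + m') n = P m n + P m' n" "P m (n + n') = P m n + P m n'"
    and P_lact: "P (lact a m) n = a * P m n"
    for m m' n n' a
    by (simp_all add: P_def \<epsilon>_add hom)
  \<comment> \<open>The right action on the conjugate bimodule is the starred left action, so right
    linearity of \<phi> becomes a rule for the second slot.\<close>
  have P_lact_star: "P m (lact (starA a) n) = P m n * a" for m n a
    by (simp add: P_def ractbar[symmetric] hom)
  have P_scale_left: "P (scale c m) n = scaleA c 1 * P m n" for c m n
    using P_lact by (simp flip: M.lact_scale_one)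
  \<comment> \<open>The involution fixes \<open>scaleA c 1\<close>, so the scalar emerges without
    conjugation, but to the right of \<open>P m n\<close>.\<close>
  have P_scale_right: "P m (scale c n) = P m n * scaleA c 1" for c m n
    using P_lact_star[of m "scaleA c 1" n]
    by (simp add: A.star_scale A.star_one M.lact_scale_one)
  have "ternary_algebra scale \<tau>"
    unfolding ternary_algebra_def
  proof (intro conjI allI)
    show "vector_space scale"
      by (fact M.vector_space_axioms)
  next
    fix m p
    show "Vector_Spaces.linear scale scale (\<lambda>a. \<tau> a m p)"
      by unfold_locales
        (simp_all add: \<tau> P_add P_scale_left M.lact_add_left M.lact_mult M.lact_scale_one)
    \<comment> \<open>Here the scalar hits \<open>p\<close> before \<open>P m b\<close> does;
      \<open>lact_scale\<close> then moves it outside.\<close>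
    show "Vector_Spaces.linear scale scale (\<lambda>b. \<tau> m b p)"
      by unfold_locales
        (simp_all add: \<tau> P_add P_scale_right M.lact_add_left M.lact_mult M.lact_scale_one
          M.lact_scale)
    show "Vector_Spaces.linear scale scale (\<lambda>c. \<tau> m p c)"
      by unfold_locales (simp_all add: \<tau> M.lact_add_right M.lact_scale)
  qed
  moreover have "lr_partially_associative \<tau>"
    by (simp add: lr_partially_associative_def \<tau> P_lact M.lact_mult)
  ultimately show ?thesis ..
qed

end
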